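(* Let $A\subset[0,1]$ and let $a=(a_i)_{i\ge1}\in A^{\mathbb{N}}$ be such that for some $n\in\mathbb{N}$ we have $[T(a)]_n<\frac18$. Then $[T^2(a)]_n<\frac{15}{16}$.
   Context: $\mathbb{N}=\{1,2,\ldots\}$. $T:\mathbb{R}^{\mathbb{N}}\to\mathbb{R}^{\mathbb{N}}$ is the Cesaro operator, $[T(a)]_n=\frac{a_1+\cdots+a_n}{n}$, where $[b]_n$ denotes the $n$-th term of a sequence $b$, and $T^2=T\circ T$. *)

theory Defs
  imports Complex_Main
begin

text \<open>
  Sequences indexed by the positive integers are functions \<open>nat \<Rightarrow> real\<close> of which only the
  values at indices \<open>n \<ge> 1\<close> are meaningful; the value at index 0 is never used.
\<close>

definition cesaro :: "(nat \<Rightarrow> real) \<Rightarrow> nat \<Rightarrow> real" where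
  "cesaro a n = (\<Sum>i = 1..n. a i) / real n"

end

theory Submission
  imports Defs
begin

text \<open>
  Let \<open>S k = a 1 + \<dots> + a k\<close>. For \<open>k \<le> n\<close> we have \<open>S k \<le> k\<close> and \<open>S k \<le> S n < n / 8\<close>, so the \<open>k\<close>-th mean
  is at most \<open>min 1 (n / (8 k))\<close>. As a function of \<open>x = k / n\<close> this lies below the line \<open>9/8 - x\<close>, the
  chord of the convex function \<open>1 / (8 x)\<close> over \<open>[1/8, 1]\<close>. Averaging the line over \<open>k\<close> gives less than
  \<open>5/8\<close>.
\<close>

lemma cesaro_le_chord:
  assumes bounds: "\<And>i. i \<ge> 1 \<Longrightarrow> 0 \<le> a i \<and> a i \<le> 1"
    and mean: "cesaro a n \<le> 1 / 8"
    and k: "1 \<le> k" "k \<le> n"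
  shows "cesaro a k \<le> 9 / 8 - real k / real n"
proof -
  let ?S = "\<Sum>i = 1..k. a i"
  have S_le_k: "?S \<le> real k"
    using sum_mono[of "{1..k}" a "\<lambda>_. 1"] bounds by simp
  have "?S \<le> (\<Sum>i = 1..n. a i)"
    using k bounds by (intro sum_mono2) auto
  also have "\<dots> \<le> real n / 8"
    using mean k by (simp add: cesaro_def field_simps)
  finally have S_le_n: "?S \<le> real n / 8" .
  \<comment> \<open>The claim multiplied by \<open>k * n\<close>. The bounds \<open>k\<close> and
    \<open>n / 8\<close> on \<open>?S\<close> cross at \<open>k = n / 8\<close>; up to there the
    line is at least 1.\<close>
  have "?S * real n \<le> (9 / 8 * real n - real k) * real k"
  proof (cases "real k \<le> real n / 8")
    case True
    have "?S * real n \<le> real k * real n"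
      using S_le_k by (simp add: mult_right_mono)
    also have "\<dots> \<le> real k * (9 / 8 * real n - real k)"
      using True by (intro mult_left_mono) auto
    finally show ?thesis by (simp add: mult.commute)
  next
    case False
    have "?S * real n \<le> real n / 8 * real n"
      using S_le_n by (rule mult_right_mono) simp
    \<comment> \<open>The product equals \<open>(9/8 * n - k) * k - n / 8 * n\<close>; its roots are
      the two ends of the chord.\<close>
    moreover have "0 \<le> (real k - real n / 8) * (real n - real k)"
      using False k by simp
    ultimately show ?thesis by (simp add: field_simps)
  qed
  then show ?thesis
    using k by (simp add: cesaro_def field_simps)
qed

theorem proposition4p12:
  fixes A :: "real set" and a :: "nat \<Rightarrow> real" and n :: nat
  assumes "A \<subseteq> {0..1}"
    and "\<And>i. i \<ge> 1 \<Longrightarrow> a i \<in> A"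
    and "n \<ge> 1"
    and "cesaro a n < 1 / 8"
  shows "(cesaro \<circ> cesaro) a n < 15 / 16"
proof -
  have bounds: "0 \<le> a i \<and> a i \<le> 1" if "i \<ge> 1" for i
    using assms(1) assms(2)[OF that] by auto
  have "(\<Sum>k = 1..n. cesaro a k) \<le> (\<Sum>k = 1..n. 9 / 8 - real k / real n)"
    using assms(4) by (intro sum_mono cesaro_le_chord bounds) auto
  also have "\<dots> = 9 / 8 * real n - (\<Sum>k = 1..n. real k) / real n"
    by (simp add: sum_subtractf sum_divide_distrib)
  also have "(\<Sum>k = 1..n. real k) = real n * (real n + 1) / 2"
    by (induction n) (auto simp: field_simps)
  \<comment> \<open>The left side is \<open>5/8 * n - 1/2\<close>, well below the required
    bound.\<close>
  also have "9 / 8 * real n - real n * (real n + 1) / 2 / real n < 15 / 16 * real n"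
    using assms(3) by (simp add: field_split_simps add_pos_pos)
  finally show ?thesis
    using assms(3) by (simp add: cesaro_def[of "cesaro a"] field_simps)
qed

end
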